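(* Let $X$ be a real Banach space. Then $X$ is fully Mackey complete if and only if the following condition holds: for every norming and norm-closed linear subspace $Y\subset X^*$ and every $x^*\in X^*\setminus Y$ there exists an absolutely convex $w^*$-compact set $K\subset X^*$ such that $K\subset Y\oplus[x^*]$ and $x^*\in\overline{K\cap Y}^{w^*}$.
   Context: $[x^*]$ denotes the linear span of $x^*$. A linear subspace $Y\subset X^*$ is norming if $|||x|||=\sup\{x^*(x): x^*\in Y,\ \|x^*\|\le 1\}$ defines an equivalent norm on $X$. For a $w^*$-dense subspace $Y\subset X^*$, $\mu(X,Y)$ is the Mackey topology on $X$: the locally convex topology of uniform convergence on absolutely convex $w^*$-compact subsets of $Y$. $X$ is fully Mackey complete if $(X,\mu(X,Y))$ is complete for every norming and norm-closed subspace $Y\subset X^*$. *)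

theory Defs
  imports "HOL-Analysis.Analysis"
begin

definition weak_star :: "('a::real_normed_vector \<Rightarrow>\<^sub>L real) topology" where
  "weak_star = topology_generated_by
     {{f. blinfun_apply f x \<in> U} | x U. open (U :: real set)}"

definition abs_convex :: "'b::real_vector set \<Rightarrow> bool" where
  "abs_convex K \<longleftrightarrow> convex K \<and> (\<forall>k\<in>K. \<forall>c::real. \<bar>c\<bar> \<le> 1 \<longrightarrow> c *\<^sub>R k \<in> K)"

definition norming_sup :: "('a::real_normed_vector \<Rightarrow>\<^sub>L real) set \<Rightarrow> 'a \<Rightarrow> real" where
  "norming_sup Y x = Sup {blinfun_apply f x | f. f \<in> Y \<and> norm f \<le> 1}"

definition norming :: "('a::real_normed_vector \<Rightarrow>\<^sub>L real) set \<Rightarrow> bool" where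
  "norming Y \<longleftrightarrow> subspace Y \<and>
     (\<exists>a b. 0 < a \<and> 0 < b \<and>
        (\<forall>x. a * norm x \<le> norming_sup Y x \<and> norming_sup Y x \<le> b * norm x))"

definition mackey_set :: "('a::real_normed_vector \<Rightarrow>\<^sub>L real) set \<Rightarrow> ('a \<Rightarrow>\<^sub>L real) set \<Rightarrow> bool" where
  "mackey_set Y K \<longleftrightarrow> K \<subseteq> Y \<and> abs_convex K \<and> compactin weak_star K"

(* Cauchy filters / convergence in the uniform structure of mu(X,Y):
  uniform convergence on the sets K. *)
definition mackey_cauchy :: "('a::real_normed_vector \<Rightarrow>\<^sub>L real) set \<Rightarrow> 'a filter \<Rightarrow> bool" where
  "mackey_cauchy Y F \<longleftrightarrow> (\<forall>K. mackey_set Y K \<longrightarrow> (\<forall>e>0.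
     eventually (\<lambda>(x, y). \<forall>f\<in>K. \<bar>blinfun_apply f x - blinfun_apply f y\<bar> \<le> e) (F \<times>\<^sub>F F)))"

definition mackey_converges :: "('a::real_normed_vector \<Rightarrow>\<^sub>L real) set \<Rightarrow> 'a filter \<Rightarrow> 'a \<Rightarrow> bool" where
  "mackey_converges Y F x \<longleftrightarrow> (\<forall>K. mackey_set Y K \<longrightarrow> (\<forall>e>0.
     eventually (\<lambda>z. \<forall>f\<in>K. \<bar>blinfun_apply f z - blinfun_apply f x\<bar> \<le> e) F))"

definition mackey_complete :: "('a::real_normed_vector \<Rightarrow>\<^sub>L real) set \<Rightarrow> bool" where
  "mackey_complete Y \<longleftrightarrow> (\<forall>F. F \<noteq> bot \<and> mackey_cauchy Y F \<longrightarrow> (\<exists>x. mackey_converges Y F x))"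

definition fully_mackey_complete :: "'a::real_normed_vector itself \<Rightarrow> bool" where
  "fully_mackey_complete _ \<longleftrightarrow>
     (\<forall>Y :: ('a \<Rightarrow>\<^sub>L real) set. norming Y \<and> closed Y \<longrightarrow> mackey_complete Y)"

end

theory Submission
  imports Defs
begin

text \<open>
  By a form of Grothendieck's completeness theorem, \<open>(X, \<mu>(X,Y))\<close> is complete iff every linear
  functional \<open>\<phi>\<close> on \<open>Y\<close> that is a uniform limit of points of \<open>X\<close> on every absolutely convex
  weak-star compact set is itself given by a point of \<open>X\<close>. Assume the condition and let \<open>\<phi>\<close> be such
  a functional. It is norm bounded, because \<open>Y\<close> contains the closed absolutely convex hulls of its
  null sequences. If \<open>ker \<phi>\<close> is norming, the condition for \<open>ker \<phi>\<close> and any \<open>x* \<in> Y - ker \<phi>\<close> forces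
  \<open>\<phi> x* = 0\<close>; if it is not norming, \<open>\<phi>\<close> lies in the norm closure of \<open>X\<close> in the dual of \<open>Y\<close>, which is \<open>X\<close>.
  Conversely, let \<open>\<phi>\<close> be the coefficient of \<open>x*\<close> on \<open>Y \<oplus> [x*]\<close>. It is not given by a point of \<open>X\<close>
  since \<open>Y\<close> is total, so by completeness some \<open>K \<inter> ker \<phi> = K \<inter> Y\<close> is not weak-star closed; translating
  and rescaling such a \<open>K\<close> moves a limit point outside \<open>Y\<close> to \<open>x*\<close>.
\<close>

section \<open>The weak-star topology\<close>

lemma topspace_weak_star [simp]: "topspace weak_star = UNIV"
proof -
  have "UNIV \<in> {{f. blinfun_apply f x \<in> U} |x U. open (U :: real set)}"
    by (rule CollectI, rule exI, rule exI[of _ UNIV]) auto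
  then show ?thesis
    unfolding weak_star_def topology_generated_by_topspace by blast
qed

lemma continuous_map_weak_star_apply:
  "continuous_map weak_star euclideanreal (\<lambda>f. blinfun_apply f x)"
  unfolding continuous_map_def
proof (intro conjI allI impI)
  fix U :: "real set"
  assume "openin euclideanreal U"
  then have "open U" by simp
  then have "openin weak_star {f. blinfun_apply f x \<in> U}"
    unfolding weak_star_def by (intro topology_generated_by_Basis) blast
  then show "openin weak_star {f \<in> topspace weak_star. blinfun_apply f x \<in> U}"
    by simp
qed auto

text \<open>Weak-star is the initial topology for the evaluations, so only preimages of subbasic
  sets need checking.\<close>

lemma continuous_map_into_weak_star:
  fixes g :: "'c \<Rightarrow> 'b::real_normed_vector \<Rightarrow>\<^sub>L real"
  assumes "\<And>x. continuous_map T euclideanreal (\<lambda>t. blinfun_apply (g t) x)"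
  shows "continuous_map T weak_star g"
  unfolding weak_star_def
proof (rule continuous_on_generated_topo)
  fix W :: "('b \<Rightarrow>\<^sub>L real) set"
  assume "W \<in> {{f. blinfun_apply f x \<in> U} |x U. open (U :: real set)}"
  then obtain x and U :: "real set" where W: "W = {f. blinfun_apply f x \<in> U}" and "open U"
    by blast
  with assms[of x] have "openin T {t \<in> topspace T. blinfun_apply (g t) x \<in> U}"
    by (auto simp: continuous_map_def)
  moreover have "g -` W \<inter> topspace T = {t \<in> topspace T. blinfun_apply (g t) x \<in> U}"
    using W by auto
  ultimately show "openin T (g -` W \<inter> topspace T)" by simp
next
  show "g ` topspace T \<subseteq> \<Union> {{f. blinfun_apply f x \<in> U} |x U. open (U :: real set)}"
    using topspace_weak_star
    unfolding weak_star_def topology_generated_by_topspace by blast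
qed

lemma Hausdorff_space_weak_star: "Hausdorff_space weak_star"
  unfolding Hausdorff_space_def
proof (intro allI impI)
  fix f g :: "'a::real_normed_vector \<Rightarrow>\<^sub>L real"
  assume "f \<in> topspace weak_star \<and> g \<in> topspace weak_star \<and> f \<noteq> g"
  then obtain x where "blinfun_apply f x \<noteq> blinfun_apply g x"
    by (meson blinfun_eqI)
  from hausdorff[OF this] obtain U V where UV: "open U" "open V" "blinfun_apply f x \<in> U" "blinfun_apply g x \<in> V" "U \<inter> V = {}"
    by blast
  have op: "openin weak_star {h \<in> topspace weak_star. blinfun_apply h x \<in> W}" if "open W" for W
    using that continuous_map_weak_star_apply[of x] by (auto simp: continuous_map_def)
  show "\<exists>U V. openin weak_star U \<and> openin weak_star V \<and> f \<in> U \<and> g \<in> V \<and> disjnt U V"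
    by (rule exI[of _ "{h. blinfun_apply h x \<in> U}"], rule exI[of _ "{h. blinfun_apply h x \<in> V}"])
      (use op[of U] op[of V] UV in \<open>auto simp: disjnt_def\<close>)
qed

text \<open>With \<open>g = 0\<close> this keeps compactness under scaling; with
  \<open>c = 1 / t\<close> and \<open>g = y\<close> it later carries a limit point
  \<open>y + t *\<^sub>R v\<close> to \<open>v\<close>.\<close>

lemma continuous_map_weak_star_affine:
  "continuous_map weak_star weak_star (\<lambda>f. c *\<^sub>R (f - g))"
  by (rule continuous_map_into_weak_star)
    (simp add: blinfun.scaleR_left blinfun.diff_left,
     intro continuous_intros continuous_map_weak_star_apply)

section \<open>Weak-star compact and absolutely convex sets\<close>

lemma compactin_weak_star_sums:
  assumes "compactin weak_star K" "compactin weak_star L"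
  shows "compactin weak_star {f + g |f g. f \<in> K \<and> g \<in> L}"
proof -
  have "continuous_map (prod_topology weak_star weak_star) weak_star
          (\<lambda>p. fst p + snd p :: 'a \<Rightarrow>\<^sub>L real)"
  proof (rule continuous_map_into_weak_star)
    fix x :: 'a
    have "continuous_map (prod_topology weak_star weak_star) euclideanreal (\<lambda>p. blinfun_apply (fst p) x)"
      "continuous_map (prod_topology weak_star weak_star) euclideanreal (\<lambda>p. blinfun_apply (snd p) x)"
      using continuous_map_compose[OF continuous_map_fst continuous_map_weak_star_apply[of x]]
        continuous_map_compose[OF continuous_map_snd continuous_map_weak_star_apply[of x]]
      by (auto simp: o_def)
    then show "continuous_map (prod_topology weak_star weak_star) euclideanreal
        (\<lambda>t. blinfun_apply (fst t + snd t) x)"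
      unfolding blinfun.add_left by (rule continuous_map_add)
  qed
  then have "compactin weak_star ((\<lambda>p. fst p + snd p) ` (K \<times> L))"
    using assms by (intro image_compactin) (auto simp: compactin_Times)
  moreover have "(\<lambda>p. fst p + snd p) ` (K \<times> L) = {f + g |f g. f \<in> K \<and> g \<in> L}"
    by force
  ultimately show ?thesis by simp
qed

text \<open>The norm topology is finer, so the identity into weak-star is continuous. Segments and
  sets of series become Mackey sets in this way.\<close>

lemma compactin_weak_star_if_compact:
  assumes "compact K"
  shows "compactin weak_star K"
proof -
  have "continuous_map euclidean weak_star (\<lambda>f::'a \<Rightarrow>\<^sub>L real. f)"
    by (rule continuous_map_into_weak_star) (auto intro!: continuous_intros)
  from image_compactin[OF _ this, of K] show ?thesis
    using assms by simp
qed

lemma abs_convex_sums: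
  assumes "abs_convex K" "abs_convex L"
  shows "abs_convex {f + g |f g. f \<in> K \<and> g \<in> L}"
  unfolding abs_convex_def
proof
  have "{f + g |f g. f \<in> K \<and> g \<in> L} = (\<Union>f\<in>K. \<Union>g\<in>L. {f + g})" by blast
  with assms show "convex {f + g |f g. f \<in> K \<and> g \<in> L}"
    using convex_sums[of K L] by (simp add: abs_convex_def)
  show "\<forall>k\<in>{f + g |f g. f \<in> K \<and> g \<in> L}. \<forall>c. \<bar>c\<bar> \<le> 1 \<longrightarrow>
      c *\<^sub>R k \<in> {f + g |f g. f \<in> K \<and> g \<in> L}"
  proof safe
    fix f g and c :: real
    assume "f \<in> K" "g \<in> L" "\<bar>c\<bar> \<le> 1"
    with assms have "c *\<^sub>R f \<in> K" "c *\<^sub>R g \<in> L" by (auto simp: abs_convex_def)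
    then show "\<exists>fa ga. c *\<^sub>R (f + g) = fa + ga \<and> fa \<in> K \<and> ga \<in> L"
      by (auto simp: scaleR_add_right)
  qed
qed

lemma abs_convex_scaleR_image:
  assumes "abs_convex K"
  shows "abs_convex ((\<lambda>f. c *\<^sub>R f) ` K)"
  unfolding abs_convex_def
proof
  show "convex ((\<lambda>f. c *\<^sub>R f) ` K)"
    using assms by (auto simp: abs_convex_def intro: convex_scaling)
  show "\<forall>k\<in>(\<lambda>f. c *\<^sub>R f) ` K. \<forall>d. \<bar>d\<bar> \<le> 1 \<longrightarrow> d *\<^sub>R k \<in> (\<lambda>f. c *\<^sub>R f) ` K"
  proof safe
    fix f and d :: real
    assume "f \<in> K" "\<bar>d\<bar> \<le> 1"
    with assms have "d *\<^sub>R f \<in> K" by (auto simp: abs_convex_def)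
    then show "d *\<^sub>R c *\<^sub>R f \<in> (\<lambda>f. c *\<^sub>R f) ` K"
      by (auto simp: image_iff mult.commute intro!: bexI[of _ "d *\<^sub>R f"])
  qed
qed

lemma abs_convex_Int_subspace:
  assumes "abs_convex K" "subspace Y"
  shows "abs_convex (K \<inter> Y)"
  using assms by (auto simp: abs_convex_def subspace_scale subspace_imp_convex convex_Int)

lemma abs_convex_zero:
  assumes "abs_convex K" "k \<in> K"
  shows "0 \<in> K"
  using assms unfolding abs_convex_def by (metis abs_zero scaleR_zero_left zero_le_one)

text \<open>This is a convex combination of \<open>f\<close> and
  \<open>(- c / r) *\<^sub>R g\<close> with weights \<open>1 / (1 + r)\<close> and
  \<open>r / (1 + r)\<close>. The factor depends on the bound \<open>r\<close> but not on
  \<open>c\<close>, which later gives estimates uniform over \<open>K\<close>.\<close>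

lemma abs_convex_scaled_diff:
  assumes "abs_convex K" "f \<in> K" "g \<in> K" "\<bar>c\<bar> \<le> r" "0 < r"
  shows "(1 / (1 + r)) *\<^sub>R (f - c *\<^sub>R g) \<in> K"
proof -
  have "\<bar>- c / r\<bar> \<le> 1" using assms by simp
  then have "(- c / r) *\<^sub>R g \<in> K" using assms unfolding abs_convex_def by blast
  with assms have "(1 / (1 + r)) *\<^sub>R f + (r / (1 + r)) *\<^sub>R ((- c / r) *\<^sub>R g) \<in> K"
    unfolding abs_convex_def by (intro convexD) (auto simp: add_divide_distrib[symmetric])
  then show ?thesis using assms(5) by (simp add: scaleR_diff_right)
qed

lemma abs_convex_segment: "abs_convex {c *\<^sub>R f |c. \<bar>c\<bar> \<le> (1::real)}"
  unfolding abs_convex_def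
proof
  have "{c *\<^sub>R f |c. \<bar>c\<bar> \<le> (1::real)} = (\<lambda>c. c *\<^sub>R f) ` {-1..1}"
    by (auto simp: abs_le_iff image_iff) 
  then show "convex {c *\<^sub>R f |c. \<bar>c\<bar> \<le> (1::real)}"
    by (metis convex_linear_image convex_real_interval(5) linear_scale_left linear_scaleR_left)
  show "\<forall>k\<in>{c *\<^sub>R f |c. \<bar>c\<bar> \<le> (1::real)}. \<forall>c. \<bar>c\<bar> \<le> 1 \<longrightarrow> c *\<^sub>R k \<in> {c *\<^sub>R f |c. \<bar>c\<bar> \<le> (1::real)}"
    by (auto simp: abs_mult mult_le_one)
qed

lemma compactin_weak_star_segment: "compactin weak_star {c *\<^sub>R f |c. \<bar>c\<bar> \<le> (1::real)}"
proof -
  have "{c *\<^sub>R f |c. \<bar>c\<bar> \<le> (1::real)} = (\<lambda>c. c *\<^sub>R f) ` {-1..1}"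
    by (auto simp: abs_le_iff image_iff)
  moreover have "compact ((\<lambda>c. c *\<^sub>R f) ` {-1..1::real})"
    by (intro compact_continuous_image continuous_intros) auto
  ultimately show ?thesis by (simp add: compactin_weak_star_if_compact)
qed

section \<open>Mackey sets and separation\<close>

text \<open>Through segments, uniform closeness on Mackey sets controls the value at each single
  \<open>f \<in> Y\<close>.\<close>

lemma mackey_set_segment:
  assumes "subspace Y" "f \<in> Y"
  shows "mackey_set Y {c *\<^sub>R f |c. \<bar>c\<bar> \<le> (1::real)}"
  unfolding mackey_set_def
  using assms abs_convex_segment compactin_weak_star_segment by (auto simp: subspace_scale)

text \<open>Directedness, as needed for a filter base: the sum set contains both summands because
  each contains \<open>0\<close>.\<close>

lemma mackey_set_upper_bound:
  assumes "subspace Y" "mackey_set Y K" "mackey_set Y L"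
  obtains M where "mackey_set Y M" "K \<subseteq> M" "L \<subseteq> M"
\<comment> \<open>The empty set counts as a Mackey set and does not contain
  \<open>0\<close>.\<close>
proof (cases "K = {} \<or> L = {}")
  case True
  with that assms show thesis by blast
next
  case False
  then have "0 \<in> K" "0 \<in> L"
    using assms abs_convex_zero by (auto simp: mackey_set_def)
  then have "K \<subseteq> {f + g |f g. f \<in> K \<and> g \<in> L}" "L \<subseteq> {f + g |f g. f \<in> K \<and> g \<in> L}"
    by force+
  moreover have "mackey_set Y {f + g |f g. f \<in> K \<and> g \<in> L}"
    using assms compactin_weak_star_sums abs_convex_sums
    by (auto simp: mackey_set_def intro!: subspace_add)
  ultimately show thesis using that by blast
qed

text \<open>
  The separating point is found without Hahn--Banach: by compactness finitely many points
  already tell the functional apart from the set, and the functional in the set that is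
  nearest on these points gives the separating direction.
\<close>

lemma weak_star_separation:
  assumes "abs_convex K" "compactin weak_star K" "c \<notin> K"
  obtains x where "\<And>f. f \<in> K \<Longrightarrow> \<bar>blinfun_apply f x\<bar> < blinfun_apply c x"
proof (cases "K = {}")
  case False
  \<comment> \<open>\<open>W x\<close> collects the functionals that \<open>x\<close> tells apart
    from \<open>c\<close>. Since \<open>c \<notin> K\<close>, these open sets cover
    \<open>K\<close>, and compactness leaves a finite set \<open>S\<close> of points.\<close>
  define W where "W x = {f. blinfun_apply f x \<noteq> blinfun_apply c x}" for x
  have "openin weak_star (W x)" for x
  proof -
    have "open (- {blinfun_apply c x})" by auto
    then have "openin weak_star {f \<in> topspace weak_star. blinfun_apply f x \<in> - {blinfun_apply c x}}"
      by (intro openin_continuous_map_preimage[OF continuous_map_weak_star_apply]) simp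
    then show ?thesis by (simp add: W_def)
  qed
  moreover have "K \<subseteq> \<Union> (range W)"
    using \<open>c \<notin> K\<close> by (auto simp: W_def) (metis blinfun_eqI)
  ultimately obtain \<F> where "finite \<F>" "\<F> \<subseteq> range W" "K \<subseteq> \<Union> \<F>"
    using assms(2) unfolding compactin_def by (metis (no_types, lifting) rangeE)
  then obtain S where S: "finite S" "K \<subseteq> \<Union> (W ` S)"
    by (metis finite_subset_image)
  \<comment> \<open>Squared Euclidean distance to \<open>c\<close>, measured on
    \<open>S\<close>.\<close>
  define q where "q f = (\<Sum>x\<in>S. (blinfun_apply f x - blinfun_apply c x)\<^sup>2)" for f
  have "continuous_map weak_star euclideanreal q"
    unfolding q_def using S(1)
    by (intro continuous_intros continuous_map_weak_star_apply) auto
  then have "compact (q ` K)"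
    using image_compactin[OF assms(2)] by fastforce
  then obtain g where g: "g \<in> K" "\<And>f. f \<in> K \<Longrightarrow> q g \<le> q f"
    using compact_attains_inf[of "q ` K"] False by auto
  define d where "d x = blinfun_apply c x - blinfun_apply g x" for x
  \<comment> \<open>Evaluation at \<open>x\<close> is the Euclidean inner product over
    \<open>S\<close> with the residual \<open>d\<close>, the normal direction at the nearest point
    \<open>g\<close>.\<close>
  define x where "x = (\<Sum>z\<in>S. d z *\<^sub>R z)"
  have apply_x: "blinfun_apply f x = (\<Sum>z\<in>S. d z * blinfun_apply f z)" for f :: "'a \<Rightarrow>\<^sub>L real"
    by (simp add: x_def blinfun.sum_right blinfun.scaleR_right)
  obtain z where "z \<in> S" "blinfun_apply g z \<noteq> blinfun_apply c z"
    using S g(1) by (auto simp: W_def)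
  then have "0 < (\<Sum>z\<in>S. (d z)\<^sup>2)"
    using S(1) by (intro sum_pos2[of S z]) (auto simp: d_def)
  also have "(\<Sum>z\<in>S. (d z)\<^sup>2) = blinfun_apply c x - blinfun_apply g x"
    by (simp add: apply_x d_def power2_eq_square sum_subtractf[symmetric] algebra_simps)
  finally have cg: "blinfun_apply g x < blinfun_apply c x" by simp
  \<comment> \<open>The variational inequality at a nearest point: otherwise a short move from
    \<open>g\<close> towards \<open>f\<close> would decrease \<open>q\<close>.\<close>
  have fg: "blinfun_apply f x \<le> blinfun_apply g x" if "f \<in> K" for f
  proof (rule ccontr)
    define p where "p = blinfun_apply f x - blinfun_apply g x"
    define r where "r = (\<Sum>z\<in>S. (blinfun_apply f z - blinfun_apply g z)\<^sup>2)"
    assume "\<not> ?thesis"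
    then have p: "p > 0" by (simp add: p_def)
    have r: "r \<ge> 0" by (simp add: r_def sum_nonneg)
    have t: "2 * p \<le> t * r" if "0 < t" "t \<le> 1" for t
    proof -
      have "(1 - t) *\<^sub>R g + t *\<^sub>R f \<in> K"
        using assms(1) g(1) \<open>f \<in> K\<close> that by (auto simp: abs_convex_def convex_alt)
      then have "q g \<le> q ((1 - t) *\<^sub>R g + t *\<^sub>R f)" by (rule g(2))
      also have "\<dots> = (\<Sum>z\<in>S. (blinfun_apply g z - blinfun_apply c z)\<^sup>2
          - 2 * t * (d z * blinfun_apply f z - d z * blinfun_apply g z)
          + t\<^sup>2 * (blinfun_apply f z - blinfun_apply g z)\<^sup>2)"
        unfolding q_def d_def blinfun.add_left blinfun.scaleR_left real_scaleR_def
        by (rule sum.cong[OF refl]) algebra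
      also have "\<dots> = q g - 2 * t * p + t\<^sup>2 * r"
        unfolding q_def p_def r_def apply_x
        by (simp only: sum.distrib sum_subtractf sum_distrib_left right_diff_distrib)
      finally have "t * (2 * p) \<le> t * (t * r)" by (simp add: power2_eq_square algebra_simps)
      then show ?thesis using that by simp
    qed
    \<comment> \<open>Small enough that \<open>t * r \<le> p\<close>, against
      \<open>2 * p \<le> t * r\<close>.\<close>
    define t where "t = min 1 (p / (r + 1))"
    have "0 < t" "t \<le> 1" using p r by (auto simp: t_def)
    moreover have "t * r \<le> p / (r + 1) * (r + 1)"
      using r p by (intro mult_mono) (auto simp: t_def)
    ultimately show False using t[of t] p r by simp
  qed
  have "\<bar>blinfun_apply f x\<bar> < blinfun_apply c x" if "f \<in> K" for f
  proof -
    have "(-1) *\<^sub>R f \<in> K" using assms(1) that unfolding abs_convex_def by (metis abs_minus abs_one order_refl)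
    from fg[OF this] fg[OF that] cg show ?thesis
      by (simp add: blinfun.minus_left)
  qed
  then show thesis using that by blast
qed (use that in blast)

section \<open>Functionals in the Mackey completion\<close>

text \<open>In Grothendieck's description, the functionals of this kind that are linear on
  \<open>Y\<close> form the completion of \<open>X\<close>. Only values on \<open>Y\<close> enter;
  homogeneity and additivity are separate hypotheses where they matter.\<close>

definition mackey_approximable ::
  "('a::real_normed_vector \<Rightarrow>\<^sub>L real) set \<Rightarrow> (('a \<Rightarrow>\<^sub>L real) \<Rightarrow> real) \<Rightarrow> bool" where
  "mackey_approximable Y \<phi> \<longleftrightarrow>
     (\<forall>K. mackey_set Y K \<longrightarrow> (\<forall>e>0. \<exists>x. \<forall>f\<in>K. \<bar>blinfun_apply f x - \<phi> f\<bar> \<le> e))"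

text \<open>The sets of points within \<open>e\<close> of \<open>\<phi>\<close> on a Mackey set form
  a filter base. The filter is Cauchy, and testing its limit on segments shows that the limit
  represents \<open>\<phi>\<close>.\<close>

lemma mackey_complete_imp_evaluation:
  assumes "subspace Y" "mackey_complete Y" "mackey_approximable Y \<phi>"
  obtains x where "\<And>f. f \<in> Y \<Longrightarrow> \<phi> f = blinfun_apply f x"
proof -
  define U where "U p = {x. \<forall>f\<in>fst p. \<bar>blinfun_apply f x - \<phi> f\<bar> \<le> snd p}" for p :: "('a \<Rightarrow>\<^sub>L real) set \<times> real"
  define I where "I = {p. mackey_set Y (fst p) \<and> snd p > (0::real)}"
  define F where "F = (INF p\<in>I. principal (U p))"
  have "({}, 1) \<in> I" by (simp add: I_def mackey_set_def abs_convex_def)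
  then have "I \<noteq> {}" by blast
  have "\<exists>r\<in>I. principal (U r) \<le> inf (principal (U p)) (principal (U q))"
    if "p \<in> I" "q \<in> I" for p q
  proof -
    from that obtain M where M: "mackey_set Y M" "fst p \<subseteq> M" "fst q \<subseteq> M"
      using mackey_set_upper_bound[OF assms(1)] unfolding I_def by blast
    then have "(M, min (snd p) (snd q)) \<in> I" using that by (auto simp: I_def)
    moreover have "U (M, min (snd p) (snd q)) \<subseteq> U p \<inter> U q"
      using M by (auto simp: U_def)
    ultimately show ?thesis by (metis inf_principal principal_le_iff)
  qed
  then have ev: "eventually P F \<longleftrightarrow> (\<exists>p\<in>I. \<forall>x\<in>U p. P x)" for P
    unfolding F_def using \<open>I \<noteq> {}\<close>
    by (subst eventually_INF_base) (auto simp: eventually_principal)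
  have U: "U p \<noteq> {}" if "p \<in> I" for p
    using that assms(3) by (auto simp: U_def I_def mackey_approximable_def)
  have "F \<noteq> bot"
    using U by (auto simp: trivial_limit_def ev)
  moreover have near: "\<forall>\<^sub>F x in F. \<forall>f\<in>K. \<bar>blinfun_apply f x - \<phi> f\<bar> \<le> e" if "mackey_set Y K" "e > 0" for K e
    unfolding ev by (rule bexI[of _ "(K, e)"]) (use that in \<open>auto simp: U_def I_def\<close>)
  moreover have "mackey_cauchy Y F"
    unfolding mackey_cauchy_def
  proof (intro allI impI)
    fix K and e :: real
    assume "mackey_set Y K" "e > 0"
    then have "\<forall>\<^sub>F x in F. \<forall>f\<in>K. \<bar>blinfun_apply f x - \<phi> f\<bar> \<le> e / 2"
      by (intro near) auto
    moreover have "\<bar>blinfun_apply f x - blinfun_apply f y\<bar> \<le> e"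
      if "\<forall>f\<in>K. \<bar>blinfun_apply f x - \<phi> f\<bar> \<le> e / 2" "\<forall>f\<in>K. \<bar>blinfun_apply f y - \<phi> f\<bar> \<le> e / 2" "f \<in> K" for x y f
      using that(1)[rule_format, OF that(3)] that(2)[rule_format, OF that(3)] by linarith
    ultimately show "\<forall>\<^sub>F (x, y) in F \<times>\<^sub>F F. \<forall>f\<in>K. \<bar>blinfun_apply f x - blinfun_apply f y\<bar> \<le> e"
      unfolding eventually_prod_filter by blast
  qed
  ultimately obtain x where x: "mackey_converges Y F x"
    using assms(2) unfolding mackey_complete_def by blast
  have "\<phi> f = blinfun_apply f x" if "f \<in> Y" for f
  proof (rule ccontr)
    assume "\<phi> f \<noteq> blinfun_apply f x"
    define K where "K = {c *\<^sub>R f |c. \<bar>c\<bar> \<le> (1::real)}"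
    \<comment> \<open>A third of the gap, so two errors of size \<open>e\<close> cannot bridge
      it.\<close>
    define e where "e = \<bar>\<phi> f - blinfun_apply f x\<bar> / 3"
    have "mackey_set Y K" unfolding K_def by (rule mackey_set_segment) fact+
    moreover have "e > 0" using \<open>\<phi> f \<noteq> blinfun_apply f x\<close> by (simp add: e_def)
    moreover have "f \<in> K" unfolding K_def by (rule CollectI, rule exI[of _ 1]) simp
    ultimately have "\<forall>\<^sub>F z in F. \<forall>f\<in>K. \<bar>blinfun_apply f z - \<phi> f\<bar> \<le> e"
      "\<forall>\<^sub>F z in F. \<forall>f\<in>K. \<bar>blinfun_apply f z - blinfun_apply f x\<bar> \<le> e"
      using near[of K e] x unfolding mackey_converges_def by simp_all
    then have "\<forall>\<^sub>F z in F. \<bar>blinfun_apply f z - \<phi> f\<bar> \<le> e \<and> \<bar>blinfun_apply f z - blinfun_apply f x\<bar> \<le> e"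
      by eventually_elim (use \<open>f \<in> K\<close> in blast)
    moreover have "\<not> (\<bar>blinfun_apply f z - \<phi> f\<bar> \<le> e \<and> \<bar>blinfun_apply f z - blinfun_apply f x\<bar> \<le> e)" for z
    proof -
      have "3 * e \<le> \<bar>blinfun_apply f z - \<phi> f\<bar> + \<bar>blinfun_apply f z - blinfun_apply f x\<bar>"
        unfolding e_def by simp
      with \<open>e > 0\<close> show ?thesis by linarith
    qed
    ultimately have "\<forall>\<^sub>F z in F. False" by simp
    with \<open>F \<noteq> bot\<close> show False by simp
  qed
  then show thesis using that by blast
qed

text \<open>Segments make the values at each \<open>f \<in> Y\<close> Cauchy in the reals, so
  pointwise limits exist and are linear in \<open>f\<close>. The Cauchy condition then upgrades the
  convergence to uniform convergence on Mackey sets.\<close>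

lemma mackey_cauchy_limit:
  assumes "subspace Y" "F \<noteq> bot" "mackey_cauchy Y F"
  obtains \<phi> where
    "\<forall>f\<in>Y. \<forall>g\<in>Y. \<phi> (f + g) = \<phi> f + \<phi> g"
    "\<forall>f\<in>Y. \<forall>c. \<phi> (c *\<^sub>R f) = c * \<phi> f"
    "\<forall>K. mackey_set Y K \<longrightarrow> (\<forall>e>0. \<forall>\<^sub>F x in F. \<forall>f\<in>K. \<bar>blinfun_apply f x - \<phi> f\<bar> \<le> e)"
proof -
  have "\<exists>l. ((\<lambda>x. blinfun_apply f x) \<longlongrightarrow> l) F" if "f \<in> Y" for f
  proof -
    define K where "K = {c *\<^sub>R f |c. \<bar>c\<bar> \<le> (1::real)}"
    have K: "mackey_set Y K" unfolding K_def by (rule mackey_set_segment) fact+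
    have "f \<in> K" unfolding K_def by (rule CollectI, rule exI[of _ 1]) simp
    have "cauchy_filter (filtermap (blinfun_apply f) F)"
      unfolding cauchy_filter_def le_filter_def eventually_uniformity_metric
    proof safe
      fix P :: "real \<times> real \<Rightarrow> bool" and e :: real
      assume e: "e > 0" "\<forall>x y. dist x y < e \<longrightarrow> P (x, y)"
      with K assms(3) have "\<forall>\<^sub>F (x, y) in F \<times>\<^sub>F F. \<forall>f\<in>K. \<bar>blinfun_apply f x - blinfun_apply f y\<bar> \<le> e / 2"
        unfolding mackey_cauchy_def by (meson half_gt_zero)
      then have "\<forall>\<^sub>F p in F \<times>\<^sub>F F. P (blinfun_apply f (fst p), blinfun_apply f (snd p))"
        by (rule eventually_mono) (use e \<open>f \<in> K\<close> in \<open>fastforce simp: dist_real_def\<close>)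
      then show "eventually P (filtermap (blinfun_apply f) F \<times>\<^sub>F filtermap (blinfun_apply f) F)"
        by (simp add: prod_filtermap1 prod_filtermap2 filtermap_filtermap eventually_filtermap)
    qed
    moreover have "complete (UNIV :: real set)" by (rule complete_UNIV)
    moreover have "filtermap (blinfun_apply f) F \<noteq> bot" using assms(2) by (simp add: filtermap_bot_iff)
    ultimately obtain l where "filtermap (blinfun_apply f) F \<le> nhds l"
      unfolding complete_uniform by auto
    then show ?thesis by (auto simp: filterlim_def)
  qed
  then obtain \<phi> where \<phi>: "\<And>f. f \<in> Y \<Longrightarrow> ((\<lambda>x. blinfun_apply f x) \<longlongrightarrow> \<phi> f) F"
    by metis
  show thesis
  proof (rule that; intro ballI allI impI)
    fix f g assume "f \<in> Y" "g \<in> Y"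
    then have "((\<lambda>x. blinfun_apply (f + g) x) \<longlongrightarrow> \<phi> f + \<phi> g) F"
      unfolding blinfun.add_left by (intro tendsto_add \<phi>)
    from tendsto_unique[OF assms(2) \<phi>[OF subspace_add[OF assms(1) \<open>f \<in> Y\<close> \<open>g \<in> Y\<close>]] this]
    show "\<phi> (f + g) = \<phi> f + \<phi> g" .
  next
    fix f and c :: real assume "f \<in> Y"
    then have "((\<lambda>x. blinfun_apply (c *\<^sub>R f) x) \<longlongrightarrow> c * \<phi> f) F"
      unfolding blinfun.scaleR_left real_scaleR_def by (intro tendsto_mult_left \<phi>)
    from tendsto_unique[OF assms(2) \<phi>[OF subspace_scale[OF assms(1) \<open>f \<in> Y\<close>]] this]
    show "\<phi> (c *\<^sub>R f) = c * \<phi> f" .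
  next
    fix K and e :: real assume K: "mackey_set Y K" and "e > 0"
    with assms(3) have "\<forall>\<^sub>F (x, y) in F \<times>\<^sub>F F. \<forall>f\<in>K. \<bar>blinfun_apply f x - blinfun_apply f y\<bar> \<le> e"
      unfolding mackey_cauchy_def by blast
    then obtain P Q where PQ: "eventually P F" "eventually Q F"
      "\<And>x y. P x \<Longrightarrow> Q y \<Longrightarrow> \<forall>f\<in>K. \<bar>blinfun_apply f x - blinfun_apply f y\<bar> \<le> e"
      unfolding eventually_prod_filter by auto
    \<comment> \<open>With \<open>x\<close> fixed, \<open>y\<close> runs along \<open>F\<close>; the
      weak inequality survives the limit.\<close>
    have "\<bar>blinfun_apply f x - \<phi> f\<bar> \<le> e" if "P x" "f \<in> K" for x f
    proof (rule tendsto_upperbound[OF _ _ assms(2)])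
      have "f \<in> Y" using K \<open>f \<in> K\<close> by (auto simp: mackey_set_def)
      then show "((\<lambda>y. \<bar>blinfun_apply f x - blinfun_apply f y\<bar>) \<longlongrightarrow> \<bar>blinfun_apply f x - \<phi> f\<bar>) F"
        by (intro tendsto_intros \<phi>)
      show "\<forall>\<^sub>F y in F. \<bar>blinfun_apply f x - blinfun_apply f y\<bar> \<le> e"
        using PQ(2) by eventually_elim (use PQ(3) that in blast)
    qed
    with PQ(1) show "\<forall>\<^sub>F x in F. \<forall>f\<in>K. \<bar>blinfun_apply f x - \<phi> f\<bar> \<le> e"
      by (auto elim: eventually_mono)
  qed
qed

section \<open>Norming subspaces and bounded functionals\<close>

text \<open>The upper estimate always holds with \<open>b = 1\<close>, so only the lower one
  remains. Quantifying over upper bounds \<open>s\<close> removes the supremum.\<close>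

lemma norming_iff:
  "norming Y \<longleftrightarrow> subspace Y \<and>
     (\<exists>a>0. \<forall>x s. (\<forall>f\<in>Y. norm f \<le> 1 \<longrightarrow> blinfun_apply f x \<le> s) \<longrightarrow> a * norm x \<le> s)"
proof -
  have upper: "blinfun_apply f x \<le> norm x" if "norm f \<le> 1" for f :: "'a \<Rightarrow>\<^sub>L real" and x
  proof -
    have "blinfun_apply f x \<le> norm f * norm x" using norm_blinfun[of f x] by simp
    also have "\<dots> \<le> norm x" using that by (simp add: mult_left_le_one_le)
    finally show ?thesis .
  qed
  have bdd: "bdd_above {blinfun_apply f x | f. f \<in> Y \<and> norm f \<le> 1}" for x
    using upper by (auto intro!: bdd_aboveI[of _ "norm x"])
  have ne: "{blinfun_apply f x | f. f \<in> Y \<and> norm f \<le> 1} \<noteq> {}" if "subspace Y" for x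
    using subspace_0[OF that] by (auto intro!: exI[of _ 0])
  have le: "norming_sup Y x \<le> s \<longleftrightarrow> (\<forall>f\<in>Y. norm f \<le> 1 \<longrightarrow> blinfun_apply f x \<le> s)"
    if "subspace Y" for x s
    unfolding norming_sup_def cSup_le_iff[OF ne[OF that] bdd] by blast
  have "norming_sup Y x \<le> 1 * norm x" if "subspace Y" for x
    unfolding le[OF that] using upper by simp
  moreover have "(\<forall>s. norming_sup Y x \<le> s \<longrightarrow> t \<le> s) \<longleftrightarrow> t \<le> norming_sup Y x" for x t
    by (meson order_refl order_trans)
  ultimately have "norming Y \<longleftrightarrow> subspace Y \<and>
      (\<exists>a>0. \<forall>x s. norming_sup Y x \<le> s \<longrightarrow> a * norm x \<le> s)"
    unfolding norming_def by (metis zero_less_one)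
  then show ?thesis using le by (metis (no_types, lifting))
qed

text \<open>The cube of coefficients is compact by Tychonoff, and the series converges uniformly on
  it by the M-test, so the image is norm compact. This puts a whole null sequence into one Mackey
  set.\<close>

lemma mackey_set_bounded_series:
  fixes y :: "nat \<Rightarrow> 'a::real_normed_vector \<Rightarrow>\<^sub>L real"
  assumes "subspace Y" "closed Y" "\<And>n. y n \<in> Y" "\<And>n. norm (y n) \<le> (1/2) ^ n"
  shows "mackey_set Y ((\<lambda>t. \<Sum>n. t n *\<^sub>R y n) ` {t. \<forall>n. \<bar>t n\<bar> \<le> 1})"
proof -
  define C :: "(nat \<Rightarrow> real) set" where "C = {t. \<forall>n. \<bar>t n\<bar> \<le> 1}"
  define S where "S t = (\<Sum>n. t n *\<^sub>R y n)" for t :: "nat \<Rightarrow> real"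
  have le: "norm (t n *\<^sub>R y n) \<le> (1/2) ^ n" if "t \<in> C" for t n
  proof -
    have "norm (t n *\<^sub>R y n) = \<bar>t n\<bar> * norm (y n)" by simp
    also have "\<dots> \<le> 1 * (1/2) ^ n"
      using that assms(4)[of n] by (intro mult_mono) (auto simp: C_def)
    finally show ?thesis by simp
  qed
  have geo: "summable (\<lambda>n. (1/2::real) ^ n)" by (simp add: summable_geometric)
  have summable: "summable (\<lambda>n. t n *\<^sub>R y n)" if "t \<in> C" for t
    by (rule summable_comparison_test'[OF geo, of 0]) (use le[OF that] in simp)
  have sums: "(\<lambda>n. t n *\<^sub>R y n) sums S t" if "t \<in> C" for t
    using summable[OF that] unfolding S_def by (rule summable_sums)
  have C_PiE: "C = PiE UNIV (\<lambda>_. {-1..1})"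
    by (auto simp: C_def PiE_def Pi_def abs_le_iff)
  have "compactin (product_topology (\<lambda>_. euclideanreal) (UNIV :: nat set)) C"
    unfolding C_PiE compactin_PiE by simp
  then have "compact C" by (simp add: euclidean_product_topology)
  moreover have "continuous_on C S"
  proof (rule uniform_limit_theorem[where F = sequentially])
    show "uniform_limit C (\<lambda>n t. \<Sum>i<n. t i *\<^sub>R y i) S sequentially"
      unfolding S_def by (rule Weierstrass_m_test[OF _ geo]) (use le in blast)
    have "continuous_on C (\<lambda>t. t i)" for i :: nat
      by (rule continuous_on_subset[OF continuous_on_product_coordinates]) simp
    then show "\<forall>\<^sub>F n in sequentially. continuous_on C (\<lambda>t. \<Sum>i<n. t i *\<^sub>R y i)"
      by (intro always_eventually allI continuous_intros)
  qed simp
  ultimately have "compactin weak_star (S ` C)"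
    by (intro compactin_weak_star_if_compact compact_continuous_image)
  moreover have "S ` C \<subseteq> Y"
  proof safe
    fix t assume "t \<in> C"
    then have "(\<lambda>n. \<Sum>i<n. t i *\<^sub>R y i) \<longlonglongrightarrow> S t"
      using summable_LIMSEQ[OF summable] unfolding S_def by blast
    then show "S t \<in> Y"
      by (rule closed_sequentially[OF assms(2), rotated])
        (intro subspace_sum[OF assms(1)] subspace_scale[OF assms(1)] assms(3))
  qed
  moreover have "abs_convex (S ` C)"
    unfolding abs_convex_def convex_def
  proof safe
    fix s t and u v :: real
    assume *: "s \<in> C" "t \<in> C" "0 \<le> u" "0 \<le> v" "u + v = 1"
    have "(\<lambda>n. u * s n + v * t n) \<in> C"
      unfolding C_def
    proof safe
      fix n
      have "\<bar>u * s n + v * t n\<bar> \<le> u * \<bar>s n\<bar> + v * \<bar>t n\<bar>"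
        using * by (intro order_trans[OF abs_triangle_ineq]) (simp add: abs_mult)
      also have "\<dots> \<le> u * 1 + v * 1"
        using * by (intro add_mono mult_left_mono) (auto simp: C_def)
      finally show "\<bar>u * s n + v * t n\<bar> \<le> 1" using * by simp
    qed
    moreover have "S (\<lambda>n. u * s n + v * t n) = u *\<^sub>R S s + v *\<^sub>R S t"
    proof -
      have "(\<lambda>n. u *\<^sub>R (s n *\<^sub>R y n) + v *\<^sub>R (t n *\<^sub>R y n)) sums (u *\<^sub>R S s + v *\<^sub>R S t)"
        by (intro sums_add sums_scaleR_right sums *)
      then show ?thesis unfolding S_def by (simp add: sums_iff scaleR_add_left)
    qed
    ultimately show "u *\<^sub>R S s + v *\<^sub>R S t \<in> S ` C"
      by (intro image_eqI[where x = "\<lambda>n. u * s n + v * t n"]) simp_all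
  next
    fix t and c :: real
    assume *: "t \<in> C" "\<bar>c\<bar> \<le> 1"
    then have "(\<lambda>n. c * t n) \<in> C" by (auto simp: C_def abs_mult mult_le_one)
    moreover have "S (\<lambda>n. c * t n) = c *\<^sub>R S t"
      using sums_scaleR_right[OF sums[OF *(1)], of c] unfolding S_def by (simp add: sums_iff)
    ultimately show "c *\<^sub>R S t \<in> S ` C"
      by (intro image_eqI[where x = "\<lambda>n. c * t n"]) simp_all
  qed
  ultimately show ?thesis by (simp add: mackey_set_def S_def[abs_def] C_def)
qed

text \<open>If \<open>\<phi>\<close> were unbounded, some rapidly null sequence with
  \<open>\<bar>\<phi> (y n)\<bar> > n\<close> would lie in one Mackey set. A point \<open>x\<close>
  that is within 1 of \<open>\<phi>\<close> there forces
  \<open>\<bar>\<phi> (y n)\<bar> \<le> 1 + norm x\<close> for all \<open>n\<close>.\<close>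

lemma mackey_approximable_bounded:
  assumes "subspace Y" "closed Y" "mackey_approximable Y \<phi>"
    and scale: "\<And>f c. f \<in> Y \<Longrightarrow> \<phi> (c *\<^sub>R f) = c * \<phi> f"
  shows "\<exists>B>0. \<forall>f\<in>Y. \<bar>\<phi> f\<bar> \<le> B * norm f"
proof (rule ccontr)
  assume "\<not> ?thesis"
  then have *: "\<exists>f\<in>Y. \<bar>\<phi> f\<bar> > B * norm f" if "B > 0" for B
    using that by (meson not_le)
  have "\<exists>f\<in>Y. norm f \<le> (1/2) ^ n \<and> \<bar>\<phi> f\<bar> > real n" for n
  proof -
    \<comment> \<open>The factor leaves more than \<open>n + 1\<close> after \<open>f\<close> is
      rescaled to norm \<open>(1/2) ^ n\<close>.\<close>
    obtain f where f: "f \<in> Y" "\<bar>\<phi> f\<bar> > ((real n + 1) * 2 ^ n) * norm f"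
      using *[of "(real n + 1) * 2 ^ n"] by auto
    have "f \<noteq> 0" using f(2) scale[OF f(1), of 0] by auto
    define c where "c = (1/2) ^ n / norm f"
    have "c > 0" using \<open>f \<noteq> 0\<close> by (simp add: c_def)
    have "norm (c *\<^sub>R f) = (1/2) ^ n" using \<open>f \<noteq> 0\<close> by (simp add: c_def)
    moreover have "c * (((real n + 1) * 2 ^ n) * norm f) < c * \<bar>\<phi> f\<bar>"
      using f(2) \<open>c > 0\<close> by simp
    moreover have "c * (((real n + 1) * 2 ^ n) * norm f) = real n + 1"
      using \<open>f \<noteq> 0\<close> by (simp add: c_def power_divide)
    ultimately have "norm (c *\<^sub>R f) = (1/2) ^ n" "real n < \<bar>\<phi> (c *\<^sub>R f)\<bar>"
      using \<open>c > 0\<close> by (simp_all add: scale[OF f(1)] abs_mult)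
    then show ?thesis
      using subspace_scale[OF assms(1) f(1)] by (metis order_refl)
  qed
  then obtain y where y: "\<And>n. y n \<in> Y" "\<And>n. norm (y n) \<le> (1/2) ^ n" "\<And>n. \<bar>\<phi> (y n)\<bar> > real n"
    by metis
  define H where "H = (\<lambda>t. \<Sum>n. t n *\<^sub>R y n) ` {t. \<forall>n. \<bar>t n\<bar> \<le> 1}"
  have "mackey_set Y H"
    unfolding H_def by (rule mackey_set_bounded_series) (use assms y in auto)
  then obtain x where x: "\<And>f. f \<in> H \<Longrightarrow> \<bar>blinfun_apply f x - \<phi> f\<bar> \<le> 1"
    using assms(3) unfolding mackey_approximable_def by (metis zero_less_one)
  obtain n where n: "1 + norm x < real n" using reals_Archimedean2 by blast
  \<comment> \<open>The unit coefficient sequence recovers the single term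
    \<open>y n\<close>.\<close>
  have "(\<Sum>k. (if k = n then 1 else 0) *\<^sub>R y k) = (\<Sum>k\<in>{n}. (if k = n then 1 else 0) *\<^sub>R y k)"
    by (rule suminf_finite) auto
  then have "y n = (\<Sum>k. (if k = n then 1 else 0) *\<^sub>R y k)" by simp
  then have "y n \<in> H" unfolding H_def by (rule image_eqI[where x = "\<lambda>k. if k = n then 1 else 0"]) auto
  from x[OF this] have "\<bar>\<phi> (y n)\<bar> \<le> 1 + \<bar>blinfun_apply (y n) x\<bar>" by linarith
  also have "\<bar>blinfun_apply (y n) x\<bar> \<le> norm (y n) * norm x" using norm_blinfun[of "y n" x] by simp
  also have "\<dots> \<le> 1 * norm x"
    using y(2)[of n] power_le_one[of "1/2::real" n] by (intro mult_right_mono) auto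
  finally show False using n y(3)[of n] by simp
qed

text \<open>A kernel that is not norming nearly annihilates some \<open>x\<close> relative to
  \<open>norm x\<close>. On \<open>Y\<close> such an \<open>x\<close> is almost a multiple of
  \<open>\<phi>\<close>, and normalising it gives points of \<open>X\<close> that approach
  \<open>\<phi>\<close> uniformly on the unit ball of \<open>Y\<close>. As \<open>Y\<close> is
  norming, they are Cauchy in the Banach space \<open>X\<close>.\<close>

lemma evaluation_if_kernel_not_norming:
  fixes Y :: "('a::banach \<Rightarrow>\<^sub>L real) set"
  assumes "norming Y" "\<not> norming {f \<in> Y. \<phi> f = 0}" "B > 0"
    and add: "\<And>f g. f \<in> Y \<Longrightarrow> g \<in> Y \<Longrightarrow> \<phi> (f + g) = \<phi> f + \<phi> g"
    and scale: "\<And>f c. f \<in> Y \<Longrightarrow> \<phi> (c *\<^sub>R f) = c * \<phi> f"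
    and bounded: "\<And>f. f \<in> Y \<Longrightarrow> \<bar>\<phi> f\<bar> \<le> B * norm f"
  shows "\<exists>x. \<forall>f\<in>Y. \<phi> f = blinfun_apply f x"
proof -
  obtain a where sub: "subspace Y" and "a > 0"
    and a: "\<And>x s. (\<And>f. f \<in> Y \<Longrightarrow> norm f \<le> 1 \<Longrightarrow> blinfun_apply f x \<le> s) \<Longrightarrow> a * norm x \<le> s"
    using assms(1) unfolding norming_iff by blast
  have subZ: "subspace {f \<in> Y. \<phi> f = 0}"
    using sub scale[OF subspace_0[OF sub], of 0] by (auto simp: subspace_def add scale)
  have "\<exists>y\<in>Y. \<phi> y \<noteq> 0"
  proof (rule ccontr)
    assume "\<not> ?thesis"
    then have "{f \<in> Y. \<phi> f = 0} = Y" by auto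
    with assms(1,2) show False by simp
  qed
  then obtain y1 where "y1 \<in> Y" "\<phi> y1 \<noteq> 0" by blast
  define y where "y = (1 / \<phi> y1) *\<^sub>R y1"
  have y: "y \<in> Y" "\<phi> y = 1"
    using \<open>y1 \<in> Y\<close> \<open>\<phi> y1 \<noteq> 0\<close> by (auto simp: y_def scale subspace_scale[OF sub])
  \<comment> \<open>Norm bound for the projection \<open>f - \<phi> f *\<^sub>R y\<close> onto the
    kernel along \<open>y\<close>.\<close>
  define C where "C = 1 + B * norm y"
  have "C > 0" using \<open>B > 0\<close> by (auto simp: C_def intro: add_pos_nonneg)
  have approx: "\<exists>u. \<forall>f\<in>Y. \<bar>blinfun_apply f u - \<phi> f\<bar> \<le> e * norm f" if "e > 0" for e
  proof -
    \<comment> \<open>The first term keeps \<open>blinfun_apply y x\<close> away from zero; the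
      second brings the error after division by it below \<open>e * norm f\<close>.\<close>
    define d where "d = min (a / (2 * C)) (e * a / (2 * B * C))"
    have "d > 0" using \<open>a > 0\<close> \<open>C > 0\<close> \<open>B > 0\<close> that by (simp add: d_def)
    with assms(2) subZ have "\<exists>x s. (\<forall>f\<in>{f \<in> Y. \<phi> f = 0}. norm f \<le> 1 \<longrightarrow> blinfun_apply f x \<le> s) \<and> s < d * norm x"
      unfolding norming_iff not_le[symmetric] by blast
    then obtain x s where
      xs: "\<And>f. f \<in> Y \<Longrightarrow> \<phi> f = 0 \<Longrightarrow> norm f \<le> 1 \<Longrightarrow> blinfun_apply f x \<le> s" "s < d * norm x"
      by blast
    have "s \<ge> 0" using xs(1)[of 0] subspace_0[OF subZ] by simp
    then have "x \<noteq> 0" using xs(2) by auto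
    have Z: "\<bar>blinfun_apply f x\<bar> \<le> d * norm x * norm f" if "f \<in> Y" "\<phi> f = 0" for f
    proof (cases "f = 0")
      case False
      have one: "c * blinfun_apply f x \<le> s" if "\<bar>c\<bar> * norm f \<le> 1" for c
        using xs(1)[of "c *\<^sub>R f"] \<open>f \<in> Y\<close> \<open>\<phi> f = 0\<close> that subspace_scale[OF sub]
        by (simp add: scale blinfun.scaleR_left)
      have "\<bar>blinfun_apply f x\<bar> / norm f \<le> s"
        using one[of "1 / norm f"] one[of "- 1 / norm f"] False by (auto simp: abs_if)
      then show ?thesis using xs(2) False by (auto simp: divide_le_eq intro: order_trans)
    qed simp
    have main: "\<bar>blinfun_apply f x - \<phi> f * blinfun_apply y x\<bar> \<le> C * d * norm x * norm f" if "f \<in> Y" for f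
    proof -
      have "f - \<phi> f *\<^sub>R y \<in> Y" using that y sub by (simp add: subspace_diff subspace_scale)
      moreover have "\<phi> (f - \<phi> f *\<^sub>R y) = 0"
      proof -
        have "\<phi> (f + (- \<phi> f) *\<^sub>R y) = \<phi> f + \<phi> ((- \<phi> f) *\<^sub>R y)"
          by (intro add that subspace_scale[OF sub] y)
        also have "\<dots> = 0" by (simp only: scale[OF y(1)] y(2))
        finally show ?thesis by simp
      qed
      ultimately have *: "\<bar>blinfun_apply (f - \<phi> f *\<^sub>R y) x\<bar> \<le> d * norm x * norm (f - \<phi> f *\<^sub>R y)"
        by (rule Z)
      have "norm (f - \<phi> f *\<^sub>R y) \<le> norm f + \<bar>\<phi> f\<bar> * norm y"
        using norm_triangle_ineq4[of f "\<phi> f *\<^sub>R y"] by simp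
      also have "\<dots> \<le> norm f + (B * norm f) * norm y"
        using bounded[OF that] by (intro add_left_mono mult_right_mono) auto
      also have "\<dots> = C * norm f" by (simp add: C_def algebra_simps)
      finally have "d * norm x * norm (f - \<phi> f *\<^sub>R y) \<le> d * norm x * (C * norm f)"
        using \<open>d > 0\<close> by (intro mult_left_mono) auto
      with * show ?thesis
        by (simp add: blinfun.diff_left blinfun.scaleR_left mult_ac)
    qed
    \<comment> \<open>The norming constant of \<open>Y\<close> bounds \<open>norm x\<close> by the
      values of \<open>x\<close> on the unit ball. As \<open>C * d \<le> a / 2\<close>, the last
      summand can be absorbed on the left.\<close>
    have "a * norm x \<le> B * \<bar>blinfun_apply y x\<bar> + C * d * norm x"
    proof (rule a)
      fix f assume f: "f \<in> Y" "norm f \<le> 1"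
      have "\<bar>\<phi> f * blinfun_apply y x\<bar> \<le> B * 1 * \<bar>blinfun_apply y x\<bar>"
        unfolding abs_mult using bounded[OF f(1)] f(2) \<open>B > 0\<close>
        by (intro mult_right_mono) (auto intro: order_trans mult_left_mono)
      moreover have "C * d * norm x * norm f \<le> C * d * norm x * 1"
        using f(2) \<open>C > 0\<close> \<open>d > 0\<close> by (intro mult_left_mono) auto
      ultimately show "blinfun_apply f x \<le> B * \<bar>blinfun_apply y x\<bar> + C * d * norm x"
        using main[OF f(1)] by linarith
    qed
    moreover have "C * d \<le> C * (a / (2 * C))"
      using \<open>C > 0\<close> by (intro mult_left_mono) (auto simp: d_def)
    then have "C * d * norm x \<le> a / 2 * norm x"
      using \<open>C > 0\<close> by (intro mult_right_mono) auto
    ultimately have ay: "a / 2 * norm x \<le> B * \<bar>blinfun_apply y x\<bar>" by linarith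
    moreover have "a / 2 * norm x > 0" using \<open>a > 0\<close> \<open>x \<noteq> 0\<close> by simp
    ultimately have yx: "\<bar>blinfun_apply y x\<bar> > 0"
      using \<open>B > 0\<close> by (metis less_le_trans zero_less_mult_pos)
    have "C * d \<le> C * (e * a / (2 * B * C))"
      using \<open>C > 0\<close> by (intro mult_left_mono) (auto simp: d_def)
    then have "C * d * norm x \<le> e * a / (2 * B) * norm x"
      using \<open>C > 0\<close> by (intro mult_right_mono) auto
    also have "\<dots> = e / B * (a / 2 * norm x)" by simp
    also have "\<dots> \<le> e / B * (B * \<bar>blinfun_apply y x\<bar>)"
      using ay that \<open>B > 0\<close> by (intro mult_left_mono) auto
    also have "\<dots> = e * \<bar>blinfun_apply y x\<bar>" using \<open>B > 0\<close> by simp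
    finally have Cd: "C * d * norm x \<le> e * \<bar>blinfun_apply y x\<bar>" .
    have "\<bar>blinfun_apply f ((1 / blinfun_apply y x) *\<^sub>R x) - \<phi> f\<bar> \<le> e * norm f" if "f \<in> Y" for f
    proof -
      have "\<bar>blinfun_apply f ((1 / blinfun_apply y x) *\<^sub>R x) - \<phi> f\<bar>
          = \<bar>blinfun_apply f x - \<phi> f * blinfun_apply y x\<bar> / \<bar>blinfun_apply y x\<bar>"
        using yx by (simp add: blinfun.scaleR_right divide_simps flip: abs_divide)
      also have "\<dots> \<le> (e * \<bar>blinfun_apply y x\<bar> * norm f) / \<bar>blinfun_apply y x\<bar>"
        using main[OF that] mult_right_mono[OF Cd, of "norm f"] yx by (intro divide_right_mono) auto
      also have "\<dots> = e * norm f" using yx by simp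
      finally show ?thesis .
    qed
    then show ?thesis by blast
  qed
  have "\<exists>u. \<forall>f\<in>Y. \<bar>blinfun_apply f u - \<phi> f\<bar> \<le> 1 / real (Suc n) * norm f" for n
    by (rule approx) simp
  then obtain u where u: "\<And>n f. f \<in> Y \<Longrightarrow> \<bar>blinfun_apply f (u n) - \<phi> f\<bar> \<le> 1 / real (Suc n) * norm f"
    by metis
  have lim: "(\<lambda>n. blinfun_apply f (u n)) \<longlonglongrightarrow> \<phi> f" if "f \<in> Y" for f
  proof (rule LIM_zero_cancel, rule Lim_null_comparison)
    show "\<forall>\<^sub>F n in sequentially. norm (blinfun_apply f (u n) - \<phi> f) \<le> inverse (real (Suc n)) * norm f"
      using u[OF that] by (simp add: inverse_eq_divide)
    show "(\<lambda>n. inverse (real (Suc n)) * norm f) \<longlonglongrightarrow> 0"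
      using LIMSEQ_inverse_real_of_nat by (rule tendsto_mult_left_zero)
  qed
  \<comment> \<open>The norming property turns an estimate on the unit ball of \<open>Y\<close> into
    a norm estimate in \<open>X\<close>.\<close>
  have uu: "a * norm (u m - u n) \<le> 1 / real (Suc m) + 1 / real (Suc n)" for m n
  proof (rule a)
    fix f assume f: "f \<in> Y" "norm f \<le> 1"
    have "1 / real (Suc k) * norm f \<le> 1 / real (Suc k) * 1" for k
      using f(2) by (intro mult_left_mono) auto
    from this[of m] this[of n] u[OF f(1), of m] u[OF f(1), of n]
    show "blinfun_apply f (u m - u n) \<le> 1 / real (Suc m) + 1 / real (Suc n)"
      unfolding blinfun.diff_right by linarith
  qed
  have "Cauchy u"
  proof (rule metric_CauchyI)
    fix e :: real assume "e > 0"
    then have "0 < e * a / 2" using \<open>a > 0\<close> by simp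
    then obtain N where N: "inverse (real (Suc N)) < e * a / 2"
      using reals_Archimedean by blast
    have "dist (u m) (u n) < e" if "m \<ge> N" "n \<ge> N" for m n
    proof -
      have "1 / real (Suc k) \<le> inverse (real (Suc N))" if "k \<ge> N" for k
        using that by (simp add: divide_simps)
      with uu[of m n] N that have "a * norm (u m - u n) < a * e"
        by (smt (verit) field_sum_of_halves mult.commute)
      then show ?thesis using \<open>a > 0\<close> by (simp add: dist_norm)
    qed
    then show "\<exists>N. \<forall>m\<ge>N. \<forall>n\<ge>N. dist (u m) (u n) < e" by blast
  qed
  then obtain x where x: "u \<longlonglongrightarrow> x" using Cauchy_convergent_iff convergent_def by blast
  have "\<phi> f = blinfun_apply f x" if "f \<in> Y" for f
    by (rule LIMSEQ_unique[OF lim[OF that]]) (intro tendsto_intros x)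
  then show ?thesis by blast
qed

section \<open>Extending a subspace by a line\<close>

text \<open>The distance \<open>d\<close> from \<open>v\<close> to \<open>Y\<close> controls the
  coefficient: \<open>\<bar>t\<bar> * d \<le> norm (y + t *\<^sub>R v)\<close>. Hence the
  coefficients of a convergent sequence converge, and so do its components in
  \<open>Y\<close>.\<close>

lemma closed_add_line:
  fixes Y :: "'a::real_normed_vector set"
  assumes "subspace Y" "closed Y" "v \<notin> Y"
  shows "closed {y + t *\<^sub>R v |y t. y \<in> Y}"
proof -
  define d where "d = infdist v Y"
  have "Y \<noteq> {}" using subspace_0[OF assms(1)] by blast
  then have "d > 0" using assms(2,3) by (simp add: d_def infdist_pos_not_in_closed)
  have d: "\<bar>t\<bar> * d \<le> norm (y + t *\<^sub>R v)" if "y \<in> Y" for y t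
  proof (cases "t = 0")
    case False
    have "(- 1 / t) *\<^sub>R y \<in> Y" using that assms(1) by (rule subspace_scale[rotated])
    then have "d \<le> dist v ((- 1 / t) *\<^sub>R y)" unfolding d_def by (rule infdist_le)
    then have "\<bar>t\<bar> * d \<le> \<bar>t\<bar> * norm (v - (- 1 / t) *\<^sub>R y)"
      by (intro mult_left_mono) (auto simp: dist_norm)
    also have "\<dots> = norm (t *\<^sub>R (v - (- 1 / t) *\<^sub>R y))" by simp
    also have "t *\<^sub>R (v - (- 1 / t) *\<^sub>R y) = y + t *\<^sub>R v"
      using False by (simp add: scaleR_add_right)
    finally show ?thesis .
  qed simp
  show ?thesis
    unfolding closed_sequential_limits
  proof safe
    fix z l assume z: "\<forall>n. z n \<in> {y + t *\<^sub>R v |y t. y \<in> Y}" "z \<longlonglongrightarrow> l"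
    then obtain y t where yt: "\<And>n. z n = y n + t n *\<^sub>R v" "\<And>n. y n \<in> Y"
      by (simp) metis
    have dist: "d * dist (t m) (t n) \<le> dist (z m) (z n)" for m n
      using d[of "y m - y n" "t m - t n"] yt(2) subspace_diff[OF assms(1)]
      by (simp add: yt(1) dist_norm algebra_simps)
    have "Cauchy z" using z(2) by (rule LIMSEQ_imp_Cauchy)
    have "Cauchy t"
    proof (rule metric_CauchyI)
      fix e :: real assume "e > 0"
      then have "d * e > 0" using \<open>d > 0\<close> by simp
      from metric_CauchyD[OF \<open>Cauchy z\<close> this]
      obtain N where N: "\<And>m n. m \<ge> N \<Longrightarrow> n \<ge> N \<Longrightarrow> dist (z m) (z n) < d * e" by blast
      have "dist (t m) (t n) < e" if "m \<ge> N" "n \<ge> N" for m n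
      proof -
        have "d * dist (t m) (t n) < d * e" using dist[of m n] N[OF that] by linarith
        then show ?thesis using \<open>d > 0\<close> by simp
      qed
      then show "\<exists>N. \<forall>m\<ge>N. \<forall>n\<ge>N. dist (t m) (t n) < e" by blast
    qed
    then obtain s where "t \<longlonglongrightarrow> s" using Cauchy_convergent_iff convergent_def by blast
    then have "(\<lambda>n. z n - t n *\<^sub>R v) \<longlonglongrightarrow> l - s *\<^sub>R v"
      using z(2) by (intro tendsto_intros)
    then have "l - s *\<^sub>R v \<in> Y"
      by (rule closed_sequentially[OF assms(2), rotated]) (use yt in simp)
    then show "\<exists>y t. l = y + t *\<^sub>R v \<and> y \<in> Y" by (metis diff_add_cancel)
  qed
qed

lemma subspace_add_line:
  assumes "subspace Y"
  shows "subspace {y + t *\<^sub>R v |y t. y \<in> Y}"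
proof -
  have "{y + t *\<^sub>R v |y t. y \<in> Y} = {x + y |x y. x \<in> Y \<and> y \<in> span {v}}"
    by (auto simp: span_singleton)
  then show ?thesis using subspace_sums[OF assms subspace_span] by simp
qed

text \<open>
  If \<open>\<phi>\<close> vanishes exactly on a \<open>Y\<close> that cuts Mackey sets in closed sets, a single point
  \<open>x\<close> that is tiny on \<open>K \<inter> Y\<close> and agrees with \<open>\<phi>\<close> at one \<open>c \<in> K - Y\<close> approximates
  \<open>\<phi>\<close> on \<open>K\<close>, because \<open>k - (\<phi> k / \<phi> c) c\<close> lies in a fixed multiple of \<open>K \<inter> Y\<close>.
\<close>

lemma mackey_approximable_coefficient:
  assumes "subspace Y"
    and coeff: "\<And>y t. y \<in> Y \<Longrightarrow> \<phi> (y + t *\<^sub>R v) = t"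
    and closed: "\<And>K. mackey_set {y + t *\<^sub>R v |y t. y \<in> Y} K \<Longrightarrow> closedin weak_star (K \<inter> Y)"
  shows "mackey_approximable {y + t *\<^sub>R v |y t. y \<in> Y} \<phi>"
  unfolding mackey_approximable_def
proof (intro allI impI)
  fix K and e :: real
  assume K: "mackey_set {y + t *\<^sub>R v |y t. y \<in> Y} K" and "e > 0"
  then have abs: "abs_convex K" and comp: "compactin weak_star K"
    by (auto simp: mackey_set_def)
  have decomp: "k - \<phi> k *\<^sub>R v \<in> Y" if "k \<in> K" for k
    using K that coeff by (auto simp: mackey_set_def)
  show "\<exists>x. \<forall>f\<in>K. \<bar>blinfun_apply f x - \<phi> f\<bar> \<le> e"
  proof (cases "\<forall>k\<in>K. \<phi> k = 0")
    case True
    then show ?thesis using \<open>e > 0\<close> by (intro exI[of _ 0]) simp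
  next
    case False
    then obtain c where c: "c \<in> K" "\<phi> c \<noteq> 0" by blast
    have diff: "k - s *\<^sub>R k' \<in> Y" if "k \<in> K" "k' \<in> K" "\<phi> k = s * \<phi> k'" for k k' s
    proof -
      have "(k - \<phi> k *\<^sub>R v) - s *\<^sub>R (k' - \<phi> k' *\<^sub>R v) \<in> Y"
        by (intro subspace_diff[OF assms(1)] subspace_scale[OF assms(1)] decomp that)
      then show ?thesis by (simp add: that(3) algebra_simps)
    qed
    have K': "abs_convex (K \<inter> Y)" "compactin weak_star (K \<inter> Y)"
      using abs_convex_Int_subspace[OF abs assms(1)] closed_compactin[OF comp _ closed[OF K]] by auto
    have "0 \<in> K \<inter> Y" using abs_convex_zero[OF abs c(1)] subspace_0[OF assms(1)] by simp
    \<comment> \<open>Separating \<open>(1 / M) *\<^sub>R c\<close> from the weak-star compact set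
      \<open>K \<inter> Y\<close> makes \<open>x\<close> small there relative to its value at
      \<open>c\<close>.\<close>
    have sep: "\<exists>x. (\<forall>f\<in>K \<inter> Y. \<bar>blinfun_apply f x\<bar> < blinfun_apply c x / M) \<and> blinfun_apply c x > 0"
      if "M > 0" for M
    proof -
      have "(1 / M) *\<^sub>R c \<notin> Y"
      proof
        assume "(1 / M) *\<^sub>R c \<in> Y"
        then have "M *\<^sub>R ((1 / M) *\<^sub>R c) \<in> Y" by (rule subspace_scale[OF assms(1)])
        then have "\<phi> (c + 0 *\<^sub>R v) = 0" using that by (intro coeff) simp
        with c(2) show False by simp
      qed
      then have "(1 / M) *\<^sub>R c \<notin> K \<inter> Y" by blast
      from weak_star_separation[OF K' this] obtain x where
        x: "\<And>f. f \<in> K \<inter> Y \<Longrightarrow> \<bar>blinfun_apply f x\<bar> < blinfun_apply ((1 / M) *\<^sub>R c) x" by blast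
      then have "\<forall>f\<in>K \<inter> Y. \<bar>blinfun_apply f x\<bar> < blinfun_apply c x / M"
        by (simp add: blinfun.scaleR_left)
      moreover from this \<open>0 \<in> K \<inter> Y\<close> have "0 < blinfun_apply c x / M"
        by (metis abs_zero blinfun.zero_left)
      ultimately show ?thesis using that by (auto simp: zero_less_divide_iff)
    qed
    \<comment> \<open>Compactness bounds evaluations on \<open>K\<close>, but not yet
      \<open>\<phi>\<close>. If \<open>\<bar>\<phi> k\<bar>\<close> exceeds
      \<open>\<bar>\<phi> c\<bar>\<close>, then \<open>c - s *\<^sub>R k\<close> with
      \<open>s = \<phi> c / \<phi> k\<close> lies in twice \<open>K \<inter> Y\<close>, where
      \<open>x\<close> stays below half its value at \<open>c\<close>. So \<open>s\<close> times the
      bounded value at \<open>k\<close> is at least the other half, which keeps \<open>s\<close>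
      away from zero.\<close>
    obtain B where B: "B > 0" "\<And>k. k \<in> K \<Longrightarrow> \<bar>\<phi> k\<bar> \<le> B"
    proof -
      obtain x where x: "\<And>f. f \<in> K \<inter> Y \<Longrightarrow> \<bar>blinfun_apply f x\<bar> < blinfun_apply c x / 4" "blinfun_apply c x > 0"
        using sep[of 4] by auto
      have "compact ((\<lambda>f. blinfun_apply f x) ` K)"
        using image_compactin[OF comp continuous_map_weak_star_apply[of x]] by simp
      then obtain A where A: "\<forall>k\<in>K. \<bar>blinfun_apply k x\<bar> \<le> A"
        by (auto dest!: compact_imp_bounded simp: bounded_iff)
      have "\<bar>\<phi> k\<bar> \<le> max \<bar>\<phi> c\<bar> (2 * \<bar>\<phi> c\<bar> * A / blinfun_apply c x)" if "k \<in> K" for k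
      proof (cases "\<bar>\<phi> k\<bar> \<le> \<bar>\<phi> c\<bar>")
        case False
        define s where "s = \<phi> c / \<phi> k"
        have s: "\<bar>s\<bar> \<le> 1" "\<bar>s\<bar> * \<bar>\<phi> k\<bar> = \<bar>\<phi> c\<bar>" using False by (auto simp: s_def)
        have "c - s *\<^sub>R k \<in> Y" using False c that by (intro diff) (auto simp: s_def)
        then have "(1 / (1 + 1)) *\<^sub>R (c - s *\<^sub>R k) \<in> K \<inter> Y"
          using abs_convex_scaled_diff[OF abs c(1) that s(1)] subspace_scale[OF assms(1)] by auto
        from x(1)[OF this] have "\<bar>blinfun_apply c x - s * blinfun_apply k x\<bar> < blinfun_apply c x / 2"
          by (simp add: blinfun.scaleR_left blinfun.diff_left)
        then have "blinfun_apply c x / 2 \<le> \<bar>s * blinfun_apply k x\<bar>" by linarith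
        also have "\<dots> \<le> \<bar>s\<bar> * A" unfolding abs_mult using A that by (intro mult_left_mono) auto
        finally have "\<bar>\<phi> k\<bar> * (blinfun_apply c x / 2) \<le> \<bar>\<phi> k\<bar> * (\<bar>s\<bar> * A)"
          by (rule mult_left_mono) simp
        also have "\<dots> = \<bar>\<phi> c\<bar> * A" by (simp add: s(2)[symmetric])
        finally have "\<bar>\<phi> k\<bar> \<le> 2 * \<bar>\<phi> c\<bar> * A / blinfun_apply c x"
          using x(2) by (simp add: field_simps)
        then show ?thesis by simp
      qed simp
      moreover have "max \<bar>\<phi> c\<bar> (2 * \<bar>\<phi> c\<bar> * A / blinfun_apply c x) > 0" using c(2) by simp
      ultimately show thesis using that by blast
    qed
    \<comment> \<open>Makes the final error \<open>(\<bar>\<phi> c\<bar> + B) / M\<close> equal to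
      \<open>e\<close>.\<close>
    define M where "M = (\<bar>\<phi> c\<bar> + B) / e"
    have "M > 0" using \<open>e > 0\<close> B(1) by (simp add: M_def add_nonneg_pos)
    from sep[OF this] obtain x where
      x: "\<And>f. f \<in> K \<inter> Y \<Longrightarrow> \<bar>blinfun_apply f x\<bar> < blinfun_apply c x / M" "blinfun_apply c x > 0"
      by blast
    \<comment> \<open>The point \<open>r *\<^sub>R x\<close> takes the value \<open>\<phi> c\<close>
      at \<open>c\<close>.\<close>
    define r where "r = \<phi> c / blinfun_apply c x"
    have "\<bar>blinfun_apply k (r *\<^sub>R x) - \<phi> k\<bar> \<le> e" if "k \<in> K" for k
    proof -
      define s where "s = \<phi> k / \<phi> c"
      define R where "R = B / \<bar>\<phi> c\<bar>"
      have "R > 0" using B(1) c(2) by (simp add: R_def)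
      have "\<bar>s\<bar> \<le> R" using B(2)[OF that] by (simp add: s_def R_def divide_right_mono)
      have "k - s *\<^sub>R c \<in> Y" using c that by (intro diff) (auto simp: s_def)
      then have "(1 / (1 + R)) *\<^sub>R (k - s *\<^sub>R c) \<in> K \<inter> Y"
        using abs_convex_scaled_diff[OF abs that c(1) \<open>\<bar>s\<bar> \<le> R\<close> \<open>R > 0\<close>] subspace_scale[OF assms(1)] by auto
      from x(1)[OF this] have "\<bar>blinfun_apply k x - s * blinfun_apply c x\<bar> / (1 + R) \<le> blinfun_apply c x / M"
        using \<open>R > 0\<close> by (simp add: blinfun.scaleR_left blinfun.diff_left abs_divide)
      then have "\<bar>blinfun_apply k x - s * blinfun_apply c x\<bar> \<le> blinfun_apply c x / M * (1 + R)"
        using \<open>R > 0\<close> by (simp add: pos_divide_le_eq)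
      then have "\<bar>r\<bar> * \<bar>blinfun_apply k x - s * blinfun_apply c x\<bar> \<le> \<bar>r\<bar> * (blinfun_apply c x / M * (1 + R))"
        by (intro mult_left_mono) auto
      also have "\<dots> = \<bar>\<phi> c\<bar> * (1 + R) / M" using x(2) by (simp add: r_def)
      also have "\<bar>\<phi> c\<bar> * (1 + R) = \<bar>\<phi> c\<bar> + B" using c(2) by (simp add: R_def distrib_left)
      also have "(\<bar>\<phi> c\<bar> + B) / M = e" using B(1) \<open>e > 0\<close> by (simp add: M_def)
      finally have "\<bar>r * (blinfun_apply k x - s * blinfun_apply c x)\<bar> \<le> e" by (simp add: abs_mult)
      moreover have "r * (blinfun_apply k x - s * blinfun_apply c x) = blinfun_apply k (r *\<^sub>R x) - \<phi> k"
        using x(2) c(2) by (simp add: blinfun.scaleR_right r_def s_def field_simps)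
      ultimately show ?thesis by simp
    qed
    then show ?thesis by blast
  qed
qed

section \<open>The two implications\<close>

text \<open>Completeness is applied to \<open>Z\<close>, the span of \<open>Y\<close> and
  \<open>v\<close>, which is again norming and closed. Without a suitable \<open>K\<close>, the
  coefficient of \<open>v\<close> would be evaluation at some \<open>x\<close>; vanishing on the
  norming \<open>Y\<close> forces \<open>x = 0\<close>, against the coefficient 1 at
  \<open>v\<close>.\<close>

lemma mackey_complete_imp_closure_condition:
  fixes Y :: "('a::real_normed_vector \<Rightarrow>\<^sub>L real) set"
  assumes "fully_mackey_complete TYPE('a)" "norming Y" "closed Y" "v \<notin> Y"
  shows "\<exists>K. abs_convex K \<and> compactin weak_star K \<and> K \<subseteq> {y + t *\<^sub>R v |y t. y \<in> Y} \<and>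
    v \<in> weak_star closure_of (K \<inter> Y)"
proof (rule ccontr)
  assume no_K: "\<not> ?thesis"
  define Z where "Z = {y + t *\<^sub>R v |y t. y \<in> Y}"
  obtain a where sub: "subspace Y" and "a > 0"
    and a: "\<And>x s. (\<And>f. f \<in> Y \<Longrightarrow> norm f \<le> 1 \<Longrightarrow> blinfun_apply f x \<le> s) \<Longrightarrow> a * norm x \<le> s"
    using assms(2) unfolding norming_iff by blast
  have "Y \<subseteq> Z" unfolding Z_def by (rule subsetI, rule CollectI) (metis add.right_neutral scaleR_zero_left)
  have subZ: "subspace Z" unfolding Z_def by (rule subspace_add_line[OF sub])
  have "norming Z"
    unfolding norming_iff using subZ \<open>a > 0\<close> a \<open>Y \<subseteq> Z\<close> by (metis subsetD)
  moreover have "closed Z" unfolding Z_def by (rule closed_add_line) fact+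
  ultimately have complete: "mackey_complete Z"
    using assms(1) by (simp add: fully_mackey_complete_def)
  have closed: "closedin weak_star (K \<inter> Y)" if "mackey_set Z K" for K
  proof (rule ccontr)
    assume "\<not> closedin weak_star (K \<inter> Y)"
    then obtain w where w: "w \<in> weak_star closure_of (K \<inter> Y)" "w \<notin> K \<inter> Y"
      using closure_of_subset_eq[of "K \<inter> Y" weak_star] by auto
    have K: "K \<subseteq> Z" "abs_convex K" "compactin weak_star K"
      using that by (auto simp: mackey_set_def)
    then have "closedin weak_star K"
      using compactin_imp_closedin[OF Hausdorff_space_weak_star] by blast
    then have "w \<in> K" using w(1) closure_of_minimal[of "K \<inter> Y" K weak_star] by blast
    then obtain y t where yt: "w = y + t *\<^sub>R v" "y \<in> Y" using K(1) by (auto simp: Z_def)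
    then have "t \<noteq> 0" using w(2) \<open>w \<in> K\<close> by auto
    \<comment> \<open>Translating \<open>K\<close> by \<open>- y\<close> alone could spoil absolute
      convexity. Adding the whole segment through \<open>y\<close> keeps it and still covers the
      translate.\<close>
    define L where "L = {f + g |f g. f \<in> K \<and> g \<in> {c *\<^sub>R y |c. \<bar>c\<bar> \<le> (1::real)}}"
    define K2 where "K2 = (\<lambda>f. (1 / t) *\<^sub>R f) ` L"
    have "abs_convex L" unfolding L_def by (intro abs_convex_sums abs_convex_segment K)
    then have "abs_convex K2" unfolding K2_def by (rule abs_convex_scaleR_image)
    moreover have "compactin weak_star L"
      unfolding L_def by (intro compactin_weak_star_sums compactin_weak_star_segment K)
    then have "compactin weak_star K2"
      unfolding K2_def using image_compactin[OF _ continuous_map_weak_star_affine[of "1 / t" 0]] by simp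
    moreover have "L \<subseteq> Z"
      unfolding L_def using K(1) \<open>y \<in> Y\<close> \<open>Y \<subseteq> Z\<close> subZ by (auto intro!: subspace_add subspace_scale)
    then have "K2 \<subseteq> Z"
      unfolding K2_def using subZ by (auto intro!: subspace_scale)
    moreover have "v \<in> weak_star closure_of (K2 \<inter> Y)"
    proof -
      have "(\<lambda>f. (1 / t) *\<^sub>R (f - y)) w \<in> weak_star closure_of ((\<lambda>f. (1 / t) *\<^sub>R (f - y)) ` (K \<inter> Y))"
        using continuous_map_image_closure_subset[OF continuous_map_weak_star_affine] w(1) by blast
      moreover have "(1 / t) *\<^sub>R (f - y) \<in> K2 \<inter> Y" if "f \<in> K \<inter> Y" for f
      proof
        have "f - y = f + (-1) *\<^sub>R y" by simp
        then have "f - y \<in> L" unfolding L_def using that by (force intro!: exI[of _ "-1"])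
        then show "(1 / t) *\<^sub>R (f - y) \<in> K2" unfolding K2_def by blast
        show "(1 / t) *\<^sub>R (f - y) \<in> Y"
          using that \<open>y \<in> Y\<close> by (intro subspace_scale[OF sub] subspace_diff[OF sub]) auto
      qed
      then have "(\<lambda>f. (1 / t) *\<^sub>R (f - y)) ` (K \<inter> Y) \<subseteq> K2 \<inter> Y" by blast
      moreover have "(1 / t) *\<^sub>R (w - y) = v" using yt \<open>t \<noteq> 0\<close> by simp
      ultimately show ?thesis using closure_of_mono by (metis (no_types, lifting) subsetD)
    qed
    ultimately show False using no_K unfolding Z_def by blast
  qed
  \<comment> \<open>The coefficient is unique on \<open>Z\<close> because
    \<open>v \<notin> Y\<close>.\<close>
  define \<phi> where "\<phi> z = (THE t. z - t *\<^sub>R v \<in> Y)" for z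
  have coeff: "\<phi> (y + t *\<^sub>R v) = t" if "y \<in> Y" for y t
    unfolding \<phi>_def
  proof (rule the_equality)
    fix s assume "y + t *\<^sub>R v - s *\<^sub>R v \<in> Y"
    then have "(y + t *\<^sub>R v - s *\<^sub>R v) - y \<in> Y" using that by (rule subspace_diff[OF sub])
    then have "(t - s) *\<^sub>R v \<in> Y" by (simp add: algebra_simps)
    then have "(1 / (t - s)) *\<^sub>R (t - s) *\<^sub>R v \<in> Y" by (rule subspace_scale[OF sub])
    then show "s = t" using \<open>v \<notin> Y\<close> by (cases "s = t") auto
  qed (use that in simp)
  have "mackey_approximable Z \<phi>"
    unfolding Z_def
    by (rule mackey_approximable_coefficient[OF sub coeff closed[unfolded Z_def]])
  then obtain x where x: "\<And>f. f \<in> Z \<Longrightarrow> \<phi> f = blinfun_apply f x"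
    using mackey_complete_imp_evaluation[OF subZ complete] by blast
  have "blinfun_apply f x = 0" if "f \<in> Y" for f
    using x[of f] coeff[OF that, of 0] that \<open>Y \<subseteq> Z\<close> by auto
  then have "a * norm x \<le> 0" by (intro a) simp
  then have "x = 0" using \<open>a > 0\<close> by (simp add: mult_le_0_iff)
  moreover have "v \<in> Z" unfolding Z_def using subspace_0[OF sub] by (auto intro!: exI[of _ 0] exI[of _ 1])
  moreover have "\<phi> v = 1" using coeff[OF subspace_0[OF sub], of 1] by simp
  ultimately show False using x[of v] by simp
qed

text \<open>The limit functional of a Cauchy filter is bounded, so its kernel is closed. A norming
  kernel falls under the condition, which makes the functional zero; any other kernel is covered by
  \<open>evaluation_if_kernel_not_norming\<close>.\<close>

lemma mackey_complete_if_closure_condition: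
  fixes Y :: "('a::banach \<Rightarrow>\<^sub>L real) set"
  assumes condition: "\<And>(Z :: ('a \<Rightarrow>\<^sub>L real) set) v. norming Z \<Longrightarrow> closed Z \<Longrightarrow> v \<notin> Z \<Longrightarrow>
      \<exists>K. abs_convex K \<and> compactin weak_star K \<and> K \<subseteq> {y + t *\<^sub>R v |y t. y \<in> Z} \<and>
        v \<in> weak_star closure_of (K \<inter> Z)"
    and Y: "norming Y" "closed Y"
  shows "mackey_complete Y"
  unfolding mackey_complete_def
proof (intro allI impI, elim conjE)
  fix F :: "'a filter"
  assume F: "F \<noteq> bot" "mackey_cauchy Y F"
  have sub: "subspace Y" using Y(1) by (simp add: norming_def)
  obtain \<phi> where \<phi>: "\<forall>f\<in>Y. \<forall>g\<in>Y. \<phi> (f + g) = \<phi> f + \<phi> g"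
    "\<forall>f\<in>Y. \<forall>c. \<phi> (c *\<^sub>R f) = c * \<phi> f"
    "\<forall>K. mackey_set Y K \<longrightarrow> (\<forall>e>0. \<forall>\<^sub>F x in F. \<forall>f\<in>K. \<bar>blinfun_apply f x - \<phi> f\<bar> \<le> e)"
    by (rule mackey_cauchy_limit[OF sub F])
  note add = \<phi>(1)[rule_format] and scale = \<phi>(2)[rule_format]
  have ev: "\<forall>\<^sub>F x in F. \<forall>f\<in>K. \<bar>blinfun_apply f x - \<phi> f\<bar> \<le> e" if "mackey_set Y K" "e > 0" for K e
    using \<phi>(3) that by blast
  have approx: "mackey_approximable Y \<phi>"
    unfolding mackey_approximable_def
    by (intro allI impI eventually_happens'[OF F(1)] ev)
  have "\<exists>B>0. \<forall>f\<in>Y. \<bar>\<phi> f\<bar> \<le> B * norm f"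
    by (rule mackey_approximable_bounded[OF sub Y(2) approx scale])
  then obtain B where B: "B > 0" "\<forall>f\<in>Y. \<bar>\<phi> f\<bar> \<le> B * norm f" by blast
  define Z where "Z = {f \<in> Y. \<phi> f = 0}"
  have "closed Z"
    unfolding closed_sequential_limits
  proof safe
    fix f g assume f: "\<forall>n. f n \<in> Z" "f \<longlonglongrightarrow> g"
    have "g \<in> Y"
      by (rule closed_sequentially[OF Y(2) _ f(2)]) (use f(1) in \<open>simp add: Z_def\<close>)
    have "\<bar>\<phi> g\<bar> \<le> B * norm (g - f n)" for n
    proof -
      have fn: "f n \<in> Y" "\<phi> (f n) = 0" using f(1) by (auto simp: Z_def)
      have "g - f n \<in> Y" using fn \<open>g \<in> Y\<close> by (intro subspace_diff[OF sub])
      moreover from add[OF this fn(1)] have "\<phi> g = \<phi> (g - f n)" using fn(2) by simp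
      ultimately show ?thesis using B(2) by simp
    qed
    moreover have "(\<lambda>n. B * norm (g - f n)) \<longlonglongrightarrow> B * norm (g - g)"
      by (intro tendsto_intros f)
    ultimately have "\<bar>\<phi> g\<bar> \<le> 0" using LIMSEQ_le_const by fastforce
    then show "g \<in> Z" using \<open>g \<in> Y\<close> by (simp add: Z_def)
  qed
  have "\<exists>x. \<forall>f\<in>Y. \<phi> f = blinfun_apply f x"
  proof (cases "norming Z")
    case True
    \<comment> \<open>The set \<open>K\<close> given by the condition is a Mackey set of
      \<open>Y\<close>, so some \<open>x\<close> is within \<open>\<bar>\<phi> v\<bar> / 3\<close>
      of \<open>\<phi>\<close> on it. On \<open>K \<inter> Z\<close> the values at \<open>x\<close>
      are then at most that third, and so is the value of the limit point \<open>v\<close>. This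
      leaves \<open>\<bar>\<phi> v\<bar>\<close> at most two thirds of itself.\<close>
    have "\<phi> v = 0" if "v \<in> Y" for v
    proof (rule ccontr)
      assume "\<phi> v \<noteq> 0"
      then have "v \<notin> Z" by (simp add: Z_def)
      from condition[OF True \<open>closed Z\<close> this] obtain K where
        K: "abs_convex K" "compactin weak_star K" "K \<subseteq> {y + t *\<^sub>R v |y t. y \<in> Z}"
          "v \<in> weak_star closure_of (K \<inter> Z)" by blast
      have "{y + t *\<^sub>R v |y t. y \<in> Z} \<subseteq> Y"
        using that sub by (auto simp: Z_def intro!: subspace_add subspace_scale)
      with K have "mackey_set Y K" by (auto simp: mackey_set_def)
      moreover have "\<bar>\<phi> v\<bar> / 3 > 0" using \<open>\<phi> v \<noteq> 0\<close> by simp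
      ultimately obtain x where x: "\<And>f. f \<in> K \<Longrightarrow> \<bar>blinfun_apply f x - \<phi> f\<bar> \<le> \<bar>\<phi> v\<bar> / 3"
        using approx unfolding mackey_approximable_def by meson
      have "closedin weak_star K"
        using compactin_imp_closedin[OF Hausdorff_space_weak_star K(2)] .
      then have "v \<in> K" using K(4) closure_of_minimal[of "K \<inter> Z" K weak_star] by blast
      \<comment> \<open>A weak-star closed strip containing \<open>K \<inter> Z\<close>, hence also
        \<open>v\<close>.\<close>
      define T where "T = {f \<in> topspace weak_star. blinfun_apply f x \<in> {- (\<bar>\<phi> v\<bar> / 3)..\<bar>\<phi> v\<bar> / 3}}"
      have "closedin weak_star T"
        unfolding T_def by (rule closedin_continuous_map_preimage[OF continuous_map_weak_star_apply]) simp
      moreover have "K \<inter> Z \<subseteq> T" using x by (fastforce simp: T_def Z_def abs_le_iff)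
      ultimately have "v \<in> T" using K(4) closure_of_minimal[of "K \<inter> Z" T weak_star] by blast
      then have "\<bar>blinfun_apply v x\<bar> \<le> \<bar>\<phi> v\<bar> / 3" by (auto simp: T_def)
      with x[OF \<open>v \<in> K\<close>] \<open>\<phi> v \<noteq> 0\<close> show False by linarith
    qed
    then show ?thesis by (intro exI[of _ 0]) simp
  next
    case False
    then show ?thesis
      unfolding Z_def by (rule evaluation_if_kernel_not_norming[OF Y(1) _ B(1) add scale bspec[OF B(2)]])
  qed
  then obtain x where x: "\<And>f. f \<in> Y \<Longrightarrow> \<phi> f = blinfun_apply f x" by blast
  have "mackey_converges Y F x"
    unfolding mackey_converges_def
  proof (intro allI impI)
    fix K and e :: real assume K: "mackey_set Y K" "e > 0"
    then have "\<forall>f\<in>K. \<phi> f = blinfun_apply f x" using x by (auto simp: mackey_set_def)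
    with ev[OF K] show "\<forall>\<^sub>F z in F. \<forall>f\<in>K. \<bar>blinfun_apply f z - blinfun_apply f x\<bar> \<le> e" by simp
  qed
  then show "\<exists>x. mackey_converges Y F x" by blast
qed

theorem theorem3p5:
  shows "fully_mackey_complete TYPE('a::banach) \<longleftrightarrow>
    (\<forall>Y :: ('a \<Rightarrow>\<^sub>L real) set. norming Y \<and> closed Y \<longrightarrow>
      (\<forall>x'. x' \<notin> Y \<longrightarrow>
        (\<exists>K. abs_convex K \<and> compactin weak_star K \<and>
             K \<subseteq> {y + t *\<^sub>R x' | y t. y \<in> Y} \<and>
             x' \<in> weak_star closure_of (K \<inter> Y))))"
    (is "_ \<longleftrightarrow> ?condition")
proof
  assume "fully_mackey_complete TYPE('a)"
  then show ?condition
    by (intro allI impI, elim conjE) (rule mackey_complete_imp_closure_condition)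
next
  assume ?condition
  then show "fully_mackey_complete TYPE('a)"
    unfolding fully_mackey_complete_def
    by (intro allI impI, elim conjE) (rule mackey_complete_if_closure_condition, blast+)
qed

end
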